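(* Let $D\subset\mathbb{R}^\eta$ be a bounded polyhedron, let $d=2$, and let $f^k(x)=w^k\cdot x+b^k$, $k\in\{1,2\}$, be affine functions on $D$ that are irreducible (there is $x\in D$ with $f^1(x)>f^2(x)$ and there is $x\in D$ with $f^2(x)>f^1(x)$). Let $R_{\mathrm{sharp}}$ be the set of all $(x,y,z)\in D\times\mathbb{R}\times\Delta^2$ satisfying $y\le\bar h(x,z)$ and $y\ge w^k\cdot x+b^k$ for $k\in\{1,2\}$. Then $\{(x,y,z)\in R_{\mathrm{sharp}}: z\in\{0,1\}^2\}$ is an ideal MIP formulation of $S_{\max}=\{(x,y)\in D\times\mathbb{R}: y=\max\{f^1(x),f^2(x)\}\}$.
   Context: $\Delta^d=\{z\in\mathbb{R}^d_{\ge0}:\sum_k z_k=1\}$. For $t\ge 0$ and $A\subseteq\mathbb{R}^\eta$, $t\cdot A=\{ta: a\in A\}$. For $(x,z)\in D\times\Delta^2$, $\bar h(x,z)=\max\{\sum_{k=1}^2(w^k\cdot\tilde x^k+b^kz_k): x=\tilde x^1+\tilde x^2,\ \tilde x^k\in z_k\cdot D\ \forall k\}$. MIP terminology: a (valid) MIP formulation of $S\subseteq\mathbb{R}^{\eta+1}$ consists of linear constraints on $(x,y,z)\in\mathbb{R}^\eta\times\mathbb{R}\times\mathbb{R}^q$ defining a polyhedron $Q$ (its LP relaxation), together with $z\in\{0,1\}^q$, such that $S=\operatorname{Proj}_{x,y}(Q\cap(\mathbb{R}^{\eta+1}\times\{0,1\}^q))$. It is ideal if every extreme point of $Q$ lies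 in $\mathbb{R}^{\eta+1}\times\{0,1\}^q$. *)

theory Defs
  imports "HOL-Analysis.Analysis"
begin

definition unit_simplex :: "(real ^ 'd) set" where
  "unit_simplex = {z. (\<forall>k. 0 \<le> z $ k) \<and> (\<Sum>k\<in>UNIV. z $ k) = 1}"

definition binary_vectors :: "(real ^ 'q) set" where
  "binary_vectors = {z. \<forall>i. z $ i \<in> {0, 1}}"

(* On D \<times> unit_simplex, for D nonempty and compact, the set of admissible values is
   nonempty and compact, so the GREATEST is a genuine maximum. The set
   z_k D equals {0} when z_k = 0 (and D is nonempty). *)
definition hbar ::
  "(real ^ 'n) set \<Rightarrow> ('d::finite \<Rightarrow> (real ^ 'n)) \<Rightarrow> ('d \<Rightarrow> real) \<Rightarrow> (real ^ 'n) \<Rightarrow> (real ^ 'd) \<Rightarrow> real"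
where
  "hbar D w b x z =
     (GREATEST v. \<exists>xt :: 'd \<Rightarrow> (real ^ 'n).
        x = (\<Sum>k\<in>UNIV. xt k) \<and> (\<forall>k. xt k \<in> (\<lambda>a. z $ k *\<^sub>R a) ` D) \<and>
        v = (\<Sum>k\<in>UNIV. w k \<bullet> xt k + b k * z $ k))"

definition R_sharp ::
  "(real ^ 'n) set \<Rightarrow> ('d::finite \<Rightarrow> (real ^ 'n)) \<Rightarrow> ('d \<Rightarrow> real) \<Rightarrow>
    ((real ^ 'n) \<times> real \<times> (real ^ 'd)) set"
where
  "R_sharp D w b =
     {(x, y, z). x \<in> D \<and> z \<in> unit_simplex \<and> y \<le> hbar D w b x z \<and> (\<forall>k. w k \<bullet> x + b k \<le> y)}"

(* A formulation is represented by its LP relaxation Q; the formulation itself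
   is Q together with the requirement that z be a binary vector. *)
definition mip_formulation ::
  "((real ^ 'n) \<times> real \<times> (real ^ 'q)) set \<Rightarrow> ((real ^ 'n) \<times> real) set \<Rightarrow> bool"
where
  "mip_formulation Q S \<longleftrightarrow>
     polyhedron Q \<and> S = {(x, y). \<exists>z \<in> binary_vectors. (x, y, z) \<in> Q}"

definition ideal_mip_formulation ::
  "((real ^ 'n) \<times> real \<times> (real ^ 'q)) set \<Rightarrow> ((real ^ 'n) \<times> real) set \<Rightarrow> bool"
where
  "ideal_mip_formulation Q S \<longleftrightarrow>
     mip_formulation Q S \<and>
     (\<forall>x y z. (x, y, z) extreme_point_of Q \<longrightarrow> z \<in> binary_vectors)"

end

theory Submission
  imports Defs
begin

text \<open>\<open>R_sharp\<close> is the convex hull of the two hypographs \<open>{(x, y, e\<^sub>k). y \<le> f\<^sup>k x}\<close>, cut by the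
  halfspaces \<open>y \<ge> f\<^sup>k x\<close>, hence a polyhedron. Let \<open>(x, y, z)\<close> be a point of it with fractional \<open>z\<close>
  and with \<open>x = z\<^sub>1 p + z\<^sub>2 q\<close> attaining the maximum in \<open>hbar\<close>. If \<open>y < hbar\<close>, then \<open>z\<close> can be moved a
  little towards both unit vectors while \<open>x\<close> and \<open>y\<close> stay fixed. If \<open>y = hbar\<close>, then \<open>y \<ge> f\<^sup>k x\<close>
  forces \<open>f\<^sup>1 p \<ge> f\<^sup>2 p\<close> and \<open>f\<^sup>2 q \<ge> f\<^sup>1 q\<close>, so the point is a proper convex combination of
  \<open>(p, f\<^sup>1 p, e\<^sub>1)\<close> and \<open>(q, f\<^sup>2 q, e\<^sub>2)\<close>, which are both in \<open>R_sharp\<close>. In neither case is it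
  extreme.\<close>

section \<open>Coordinates on the two-dimensional simplex and the maximum
  \<open>hbar\<close>\<close>

lemma unit_simplex_2:
  "z \<in> unit_simplex \<longleftrightarrow> 0 \<le> z $ 1 \<and> 0 \<le> z $ 2 \<and> z $ 1 + z $ 2 = 1" for z :: "real ^ 2"
  by (simp add: unit_simplex_def forall_2 sum_2)

lemma ex_2: "(\<exists>i::2. P i) \<longleftrightarrow> P 1 \<or> P 2"
  by (metis exhaust_2)

lemma vec_eq_axis_combination_2:
  "z = z $ 1 *\<^sub>R axis 1 1 + z $ 2 *\<^sub>R axis 2 1" for z :: "real ^ 2"
  by (simp add: vec_eq_iff forall_2 axis_def)

lemma axis_in_binary_vectors: "axis k 1 \<in> binary_vectors"
  by (simp add: binary_vectors_def axis_def)

text \<open>The value is continuous on the compact set of admissible pairs \<open>(p, q)\<close>, so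
  the \<open>GREATEST\<close> is attained, and lying below a maximum means lying below some
  admissible value.\<close>

lemma le_hbar_iff:
  fixes D :: "(real ^ 'n) set" and z :: "real ^ 2"
  assumes D: "compact D" "convex D" and "x \<in> D" "z \<in> unit_simplex"
  shows "y \<le> hbar D w b x z \<longleftrightarrow>
    (\<exists>p\<in>D. \<exists>q\<in>D. x = z $ 1 *\<^sub>R p + z $ 2 *\<^sub>R q \<and>
       y \<le> z $ 1 * (w 1 \<bullet> p + b 1) + z $ 2 * (w 2 \<bullet> q + b 2))"
proof -
  define val where "val u = z $ 1 * (w 1 \<bullet> fst u + b 1) + z $ 2 * (w 2 \<bullet> snd u + b 2)" for u
  define K where "K = (D \<times> D) \<inter> {u. x = z $ 1 *\<^sub>R fst u + z $ 2 *\<^sub>R snd u}"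
  have "closed {u. x = z $ 1 *\<^sub>R fst u + z $ 2 *\<^sub>R snd u}"
    by (intro closed_Collect_eq continuous_intros)
  then have "compact K"
    unfolding K_def using D by (intro compact_Int_closed compact_Times)
  \<comment> \<open>As the weights sum to 1, taking both points equal to \<open>x\<close> is
    admissible.\<close>
  moreover have "(x, x) \<in> K"
    using assms(3,4) by (auto simp: K_def unit_simplex_2 simp flip: scaleR_left_distrib)
  then have "K \<noteq> {}" by blast
  moreover have "continuous_on K val"
    unfolding val_def by (intro continuous_intros)
  ultimately obtain m where m: "m \<in> K" "\<And>u. u \<in> K \<Longrightarrow> val u \<le> val m"
    using continuous_attains_sup[of K val] by auto
  have admissible:
    "(\<exists>xt :: 2 \<Rightarrow> real ^ 'n. x = (\<Sum>k\<in>UNIV. xt k) \<and> (\<forall>k. xt k \<in> (\<lambda>a. z $ k *\<^sub>R a) ` D) \<and>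
       v = (\<Sum>k\<in>UNIV. w k \<bullet> xt k + b k * z $ k)) \<longleftrightarrow> (\<exists>u\<in>K. v = val u)" (is "?L \<longleftrightarrow> ?R") for v
  proof
    assume ?L
    then obtain xt where xt: "x = xt 1 + xt 2" "\<forall>k. xt k \<in> (\<lambda>a. z $ k *\<^sub>R a) ` D"
      "v = (w 1 \<bullet> xt 1 + b 1 * z $ 1) + (w 2 \<bullet> xt 2 + b 2 * z $ 2)"
      unfolding sum_2 by (elim exE conjE) (rule that)
    obtain p q where "p \<in> D" "xt 1 = z $ 1 *\<^sub>R p" "q \<in> D" "xt 2 = z $ 2 *\<^sub>R q"
      using xt(2)[THEN spec, of 1] xt(2)[THEN spec, of 2] by (elim imageE) (rule that)
    with xt(1,3) show ?R
      by (intro bexI[of _ "(p, q)"]) (simp_all add: K_def val_def algebra_simps)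
  next
    assume ?R
    then obtain p q where "p \<in> D" "q \<in> D" "x = z $ 1 *\<^sub>R p + z $ 2 *\<^sub>R q" "v = val (p, q)"
      by (auto simp: K_def)
    then show ?L
      by (intro exI[of _ "\<lambda>k. z $ k *\<^sub>R (if k = 1 then p else q)"])
         (auto simp: sum_2 forall_2 val_def algebra_simps)
  qed
  have "hbar D w b x z = val m"
    unfolding hbar_def admissible using m by (intro Greatest_equality) auto
  then have "y \<le> hbar D w b x z \<longleftrightarrow> (\<exists>u\<in>K. y \<le> val u)"
    using m by (auto intro: order_trans)
  then show ?thesis
    unfolding K_def val_def Bex_def split_paired_Ex by (simp add: conj_ac)
qed

section \<open>Truncated hypographs and their convex hull\<close>

text \<open>The part above height \<open>-N\<close> of the hypograph of the \<open>k\<close>-th affine function, tagged with the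
  \<open>k\<close>-th unit vector. The truncation makes it a polytope, so that the convex hull of two of them is
  again one.\<close>
definition slab ::
  "(real ^ 'n) set \<Rightarrow> ('d::finite \<Rightarrow> real ^ 'n) \<Rightarrow> ('d \<Rightarrow> real) \<Rightarrow> real \<Rightarrow> 'd \<Rightarrow>
    ((real ^ 'n) \<times> real \<times> (real ^ 'd)) set"
  where "slab D w b N k = {(x, y, z). x \<in> D \<and> z = axis k 1 \<and> - N \<le> y \<and> y \<le> w k \<bullet> x + b k}"

text \<open>The bound \<open>N\<close> puts the slab inside a product of polytopes, where it is cut
  out by the single halfspace \<open>y - w k \<bullet> x \<le> b k\<close>.\<close>

lemma polytope_slab:
  fixes D :: "(real ^ 'n) set" and w :: "'d::finite \<Rightarrow> real ^ 'n"
  assumes "polytope D" and N: "\<forall>x\<in>D. \<bar>w k \<bullet> x + b k\<bar> \<le> N"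
  shows "polytope (slab D w b N k)"
proof -
  have "slab D w b N k =
    (D \<times> cbox (- N) N \<times> {axis k 1}) \<inter> {v. (- w k, 1, 0) \<bullet> v \<le> b k}"
    using N by (fastforce simp: slab_def inner_prod_def)
  moreover have "polytope (D \<times> cbox (- N) N \<times> {axis k 1 :: real ^ 'd})"
    using assms(1) by (intro polytope_Times polytope_interval polytope_sing)
  ultimately show ?thesis
    by (simp add: polytope_Int_polyhedron polyhedron_halfspace_le)
qed

text \<open>A point of the hull is a convex combination of one point from each slab, and the
  unit-vector tags force its weights to be the coordinates of \<open>z\<close>.\<close>

lemma slab_hull_iff:
  fixes D :: "(real ^ 'n) set" and w :: "2 \<Rightarrow> real ^ 'n"
  assumes "polytope D" "D \<noteq> {}" and N: "\<forall>k. \<forall>x\<in>D. \<bar>w k \<bullet> x + b k\<bar> \<le> N"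
  shows "(x, y, z) \<in> convex hull (slab D w b N 1 \<union> slab D w b N 2) \<longleftrightarrow>
    z \<in> unit_simplex \<and> - N \<le> y \<and>
    (\<exists>p\<in>D. \<exists>q\<in>D. x = z $ 1 *\<^sub>R p + z $ 2 *\<^sub>R q \<and>
       y \<le> z $ 1 * (w 1 \<bullet> p + b 1) + z $ 2 * (w 2 \<bullet> q + b 2))"
    (is "?L \<longleftrightarrow> ?R")
proof -
  have convex: "convex (slab D w b N k)" for k
    using assms(1) N by (simp add: polytope_slab polytope_imp_convex)
  have nonempty: "slab D w b N k \<noteq> {}" for k
  proof -
    obtain x where "x \<in> D" using assms(2) by blast
    then have "(x, w k \<bullet> x + b k, axis k 1) \<in> slab D w b N k"
      using N[rule_format, of x k] by (auto simp: slab_def)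
    then show ?thesis by blast
  qed
  note hull = convex_hull_union_two[OF convex nonempty convex nonempty]
  show ?thesis
  proof
    assume ?L
    then obtain u v p yp q yq where *: "0 \<le> u" "0 \<le> v" "u + v = 1" "p \<in> D" "q \<in> D"
      "- N \<le> yp" "yp \<le> w 1 \<bullet> p + b 1" "- N \<le> yq" "yq \<le> w 2 \<bullet> q + b 2"
      "x = u *\<^sub>R p + v *\<^sub>R q" "y = u * yp + v * yq" "z = u *\<^sub>R axis 1 1 + v *\<^sub>R axis 2 1"
      unfolding hull by (auto simp: slab_def)
    then have z: "z $ 1 = u" "z $ 2 = v"
      by (simp_all add: axis_def)
    have "u * (- N) + v * (- N) \<le> y" "y \<le> u * (w 1 \<bullet> p + b 1) + v * (w 2 \<bullet> q + b 2)"
      unfolding *(11) by (intro add_mono mult_left_mono *)+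
    moreover have "u * (- N) + v * (- N) = - N"
      by (simp only: *(3) mult_1 flip: distrib_right)
    moreover have "z \<in> unit_simplex"
      using *(1-3) z by (simp add: unit_simplex_2)
    ultimately show ?R
      using *(4,5,10) unfolding z by auto
  next
    assume ?R
    then obtain p q where *: "0 \<le> z $ 1" "0 \<le> z $ 2" "z $ 1 + z $ 2 = 1" "- N \<le> y" "p \<in> D" "q \<in> D"
      "x = z $ 1 *\<^sub>R p + z $ 2 *\<^sub>R q"
      "y \<le> z $ 1 * (w 1 \<bullet> p + b 1) + z $ 2 * (w 2 \<bullet> q + b 2)" (is "y \<le> ?v")
      by (auto simp: unit_simplex_2)
    define f1 f2 where "f1 = w 1 \<bullet> p + b 1" and "f2 = w 2 \<bullet> q + b 2"
    have f: "- N \<le> f1" "- N \<le> f2"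
      using N[rule_format, OF *(5), of 1] N[rule_format, OF *(6), of 2] by (auto simp: f1_def f2_def)
    \<comment> \<open>Both slab points are lowered from their tops \<open>f1\<close>,
      \<open>f2\<close> towards \<open>- N\<close> by the same fraction \<open>t\<close>, chosen so
      that the weighted height drops from \<open>?v\<close> to exactly \<open>y\<close>.\<close>
    have "y \<in> closed_segment ?v (- N)"
      using *(4,8) by (simp add: closed_segment_eq_real_ivl)
    then obtain t where t: "0 \<le> t" "t \<le> 1" "y = (1 - t) * ?v + t * (- N)"
      by (auto simp: in_segment)
    define y1 y2 where "y1 = (1 - t) * f1 + t * (- N)" and "y2 = (1 - t) * f2 + t * (- N)"
    moreover have "- N = (1 - t) * (- N) + t * (- N)"
      by (simp add: algebra_simps)
    ultimately have lb: "- N \<le> y1" "- N \<le> y2"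
      using f t by (metis add_right_mono diff_ge_0_iff_ge mult_left_mono)+
    have ub: "y1 \<le> f1" "y2 \<le> f2"
      using f t mult_left_mono[of "- N" f1 t] mult_left_mono[of "- N" f2 t]
      by (simp_all add: y1_def y2_def algebra_simps)
    have "z $ 1 * y1 + z $ 2 * y2 = (1 - t) * ?v + t * (- N * (z $ 1 + z $ 2))"
      unfolding y1_def y2_def f1_def f2_def by (simp add: algebra_simps)
    then have "y = z $ 1 * y1 + z $ 2 * y2"
      using t(3) *(3) by simp
    moreover have "(p, y1, axis 1 1) \<in> slab D w b N 1" "(q, y2, axis 2 1) \<in> slab D w b N 2"
      using lb ub * by (auto simp: slab_def f1_def f2_def)
    ultimately show ?L
      unfolding hull using * vec_eq_axis_combination_2[of z]
      by (smt (verit, best) mem_Collect_eq add_Pair scaleR_Pair real_scaleR_def)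
  qed
qed

section \<open>\<open>R_sharp\<close> as a polyhedron\<close>

lemma mem_R_sharp_iff:
  fixes D :: "(real ^ 'n) set" and w :: "2 \<Rightarrow> real ^ 'n"
  assumes "polytope D"
  shows "(x, y, z) \<in> R_sharp D w b \<longleftrightarrow> z \<in> unit_simplex \<and> (\<forall>k. w k \<bullet> x + b k \<le> y) \<and>
    (\<exists>p\<in>D. \<exists>q\<in>D. x = z $ 1 *\<^sub>R p + z $ 2 *\<^sub>R q \<and>
       y \<le> z $ 1 * (w 1 \<bullet> p + b 1) + z $ 2 * (w 2 \<bullet> q + b 2))"
proof -
  have D: "compact D" "convex D"
    using assms polytope_imp_compact polytope_imp_convex by auto
  \<comment> \<open>Convexity of \<open>D\<close> recovers the constraint \<open>x \<in> D\<close>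
    from the decomposition.\<close>
  have "x \<in> D" if "z \<in> unit_simplex" "p \<in> D" "q \<in> D" "x = z $ 1 *\<^sub>R p + z $ 2 *\<^sub>R q" for p q
    using that D(2) by (auto simp: unit_simplex_2 intro: convexD)
  then show ?thesis
    using le_hbar_iff[OF D, of x z y w b] by (auto simp: R_sharp_def)
qed

text \<open>The truncation loses nothing: on \<open>R_sharp\<close> the height is at least
  \<open>w 1 \<bullet> x + b 1\<close>, hence at least \<open>- N\<close>.\<close>

lemma R_sharp_eq_slab_hull:
  fixes D :: "(real ^ 'n) set" and w :: "2 \<Rightarrow> real ^ 'n"
  assumes "polytope D" "D \<noteq> {}" and N: "\<forall>k. \<forall>x\<in>D. \<bar>w k \<bullet> x + b k\<bar> \<le> N"
  shows "R_sharp D w b = convex hull (slab D w b N 1 \<union> slab D w b N 2) \<inter>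
    (\<Inter>k. {v. (w k, -1, 0) \<bullet> v \<le> - b k})" (is "_ = ?P \<inter> ?H")
proof -
  have "(x, y, z) \<in> R_sharp D w b \<longleftrightarrow> (x, y, z) \<in> ?P \<inter> ?H" for x y z
  proof -
    have H: "(x, y, z) \<in> ?H \<longleftrightarrow> (\<forall>k. w k \<bullet> x + b k \<le> y)"
      by (auto simp: inner_prod_def algebra_simps)
    have "- N \<le> y" if "(x, y, z) \<in> R_sharp D w b"
    proof -
      have "x \<in> D" "w 1 \<bullet> x + b 1 \<le> y"
        using that by (auto simp: R_sharp_def)
      then show ?thesis using N[rule_format, of x 1] by auto
    qed
    then show ?thesis
      unfolding IntI Int_iff H slab_hull_iff[OF assms] using mem_R_sharp_iff[OF assms(1)] by metis
  qed
  then show ?thesis by auto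
qed

lemma affine_family_bounded_on_polytope:
  fixes D :: "(real ^ 'n) set" and w :: "'d::finite \<Rightarrow> real ^ 'n"
  assumes "polytope D"
  obtains N where "\<forall>k. \<forall>x\<in>D. \<bar>w k \<bullet> x + b k\<bar> \<le> N"
proof -
  have "compact (\<Union>k. (\<lambda>x. w k \<bullet> x + b k) ` D)"
    using polytope_imp_compact[OF assms]
    by (intro compact_UN compact_continuous_image continuous_intros) auto
  then obtain N where "\<forall>v\<in>(\<Union>k. (\<lambda>x. w k \<bullet> x + b k) ` D). norm v \<le> N"
    using compact_imp_bounded bounded_iff by blast
  then have "\<forall>k. \<forall>x\<in>D. \<bar>w k \<bullet> x + b k\<bar> \<le> N"
    by auto
  then show ?thesis by (rule that)
qed

lemma polyhedron_R_sharp: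
  fixes D :: "(real ^ 'n) set" and w :: "2 \<Rightarrow> real ^ 'n"
  assumes D: "polytope D"
  shows "polyhedron (R_sharp D w b)"
\<comment> \<open>The hull description requires nonempty slabs.\<close>
proof (cases "D = {}")
  case True
  then have "R_sharp D w b = {}" by (auto simp: R_sharp_def)
  then show ?thesis by simp
next
  case False
  obtain N where N: "\<forall>k. \<forall>x\<in>D. \<bar>w k \<bullet> x + b k\<bar> \<le> N"
    using affine_family_bounded_on_polytope[OF D] by blast
  have "polytope (slab D w b N k)" for k
    using D N by (simp add: polytope_slab)
  then obtain V1 V2 where V: "finite V1" "slab D w b N 1 = convex hull V1"
      "finite V2" "slab D w b N 2 = convex hull V2"
    unfolding polytope_def by metis
  \<comment> \<open>The hull of two polytopes is spanned by their finitely many generators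
    together.\<close>
  have "convex hull (slab D w b N 1 \<union> slab D w b N 2) = convex hull (V1 \<union> V2)"
    unfolding V by (metis hull_Un_left hull_Un_right)
  then have "polyhedron (convex hull (slab D w b N 1 \<union> slab D w b N 2))"
    using V by (metis polytope_def finite_UnI polytope_imp_polyhedron)
  moreover have "polyhedron (\<Inter>k. {v. (w k, -1 :: real, 0 :: real ^ 2) \<bullet> v \<le> - b k})"
    by (intro polyhedron_Inter) (auto intro: polyhedron_halfspace_le)
  ultimately show ?thesis
    unfolding R_sharp_eq_slab_hull[OF D False N] by blast
qed

section \<open>Binary points and extreme points\<close>

lemma unit_simplex_2_binary_iff:
  fixes z :: "real ^ 2"
  assumes "z \<in> unit_simplex"
  shows "z \<in> binary_vectors \<longleftrightarrow> z $ 1 = 0 \<or> z $ 2 = 0"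
  using assms by (auto simp: unit_simplex_2 binary_vectors_def forall_2)

text \<open>At the \<open>k\<close>-th unit vector the other point gets weight 0, so
  \<open>x\<close> itself is the \<open>k\<close>-th point; the upper bound on \<open>y\<close> then
  meets the lower bound at \<open>w k \<bullet> x + b k\<close>.\<close>

lemma mem_R_sharp_axis:
  fixes D :: "(real ^ 'n) set" and w :: "2 \<Rightarrow> real ^ 'n"
  assumes "polytope D"
  shows "(x, y, axis k 1) \<in> R_sharp D w b \<longleftrightarrow>
    x \<in> D \<and> y = w k \<bullet> x + b k \<and> (\<forall>j. w j \<bullet> x + b j \<le> y)"
proof -
  have "k = 1 \<or> k = 2" using exhaust_2 by blast
  then show ?thesis
    unfolding mem_R_sharp_iff[OF assms] by (auto simp: axis_def unit_simplex_2 intro: antisym)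
qed

lemma extreme_point_R_sharp_binary:
  fixes D :: "(real ^ 'n) set" and w :: "2 \<Rightarrow> real ^ 'n"
  assumes D: "polytope D" and ext: "(x, y, z) extreme_point_of R_sharp D w b"
  shows "z \<in> binary_vectors"
proof (rule ccontr)
  assume nb: "z \<notin> binary_vectors"
  have R: "(x, y, z) \<in> R_sharp D w b"
    using ext by (simp add: extreme_point_of_def)
  then have "x \<in> D" and z: "z \<in> unit_simplex" and y: "\<And>k. w k \<bullet> x + b k \<le> y"
    by (auto simp: R_sharp_def)
  obtain p q where pq: "p \<in> D" "q \<in> D" "x = z $ 1 *\<^sub>R p + z $ 2 *\<^sub>R q"
      "y \<le> z $ 1 * (w 1 \<bullet> p + b 1) + z $ 2 * (w 2 \<bullet> q + b 2)" (is "y \<le> ?v")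
    using R unfolding mem_R_sharp_iff[OF D] by blast
  have zpos: "0 < z $ 1" "0 < z $ 2" "z $ 1 + z $ 2 = 1"
    using z nb unit_simplex_2_binary_iff[OF z] by (auto simp: unit_simplex_2)
  \<comment> \<open>The coordinates of \<open>z\<close> serve as the weights in both cases;
    different tags make the segment nondegenerate.\<close>
  have not_between: False
    if "a1 \<in> R_sharp D w b" "a2 \<in> R_sharp D w b" "snd (snd a1) \<noteq> snd (snd a2)"
      "(x, y, z) = z $ 1 *\<^sub>R a1 + z $ 2 *\<^sub>R a2" for a1 a2
  proof -
    have "(x, y, z) \<in> open_segment a1 a2"
      unfolding in_segment using that zpos
      by (intro conjI exI[of _ "z $ 2"]) (auto simp flip: eq_diff_eq)
    then show False
      using ext that unfolding extreme_point_of_def by blast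
  qed
  have axes: "axis 1 1 \<noteq> (axis 2 1 :: real ^ 2)"
    by (simp add: axis_eq_axis)
  have wx: "w k \<bullet> x + b k = z $ 1 * (w k \<bullet> p + b k) + z $ 2 * (w k \<bullet> q + b k)" for k
  proof -
    have "w k \<bullet> x + b k = w k \<bullet> x + (z $ 1 + z $ 2) * b k"
      by (simp add: zpos)
    then show ?thesis by (simp add: pq(3) inner_add_right algebra_simps)
  qed
  show False
  proof (cases "y = ?v")
    case True
    \<comment> \<open>After expanding by \<open>wx\<close>, the \<open>q\<close> terms cancel in
      \<open>y[of 2]\<close> and the \<open>p\<close> terms in \<open>y[of 1]\<close>.\<close>
    have "z $ 1 * (w 2 \<bullet> p + b 2) \<le> z $ 1 * (w 1 \<bullet> p + b 1)"
         "z $ 2 * (w 1 \<bullet> q + b 1) \<le> z $ 2 * (w 2 \<bullet> q + b 2)"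
      using y[of 2] y[of 1] unfolding True wx by auto
    then have "w 2 \<bullet> p + b 2 \<le> w 1 \<bullet> p + b 1" "w 1 \<bullet> q + b 1 \<le> w 2 \<bullet> q + b 2"
      using zpos by auto
    then show False
      using pq True axes vec_eq_axis_combination_2[of z]
      by (intro not_between[of "(p, w 1 \<bullet> p + b 1, axis 1 1)" "(q, w 2 \<bullet> q + b 2, axis 2 1)"])
         (auto simp: mem_R_sharp_axis[OF D] forall_2)
  next
    case False
    obtain N where N: "\<forall>k. \<forall>x\<in>D. \<bar>w k \<bullet> x + b k\<bar> \<le> N"
      using affine_family_bounded_on_polytope[OF D] by blast
    have "D \<noteq> {}" using pq by blast
    note hull = slab_hull_iff[OF D this N] and R_eq = R_sharp_eq_slab_hull[OF D this N]
    let ?P = "convex hull (slab D w b N 1 \<union> slab D w b N 2)"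
    have Ny: "- N \<le> y" using N[rule_format, OF \<open>x \<in> D\<close>, of 1] y[of 1] by auto
    \<comment> \<open>Without the summand 1, \<open>t\<close> would solve
      \<open>(1 - t) * ?v + t * (- N) = y\<close>; the summand keeps \<open>t < 1\<close> even when
      \<open>y = - N\<close>.\<close>
    define t where "t = (?v - y) / (?v + N + 1)"
    have t: "0 < t" "t < 1" "y \<le> (1 - t) * ?v + t * (- N)"
    proof -
      have pos: "0 < ?v + N + 1" "0 < ?v - y" using pq(4) False Ny by auto
      show "0 < t" "t < 1" using pos Ny by (auto simp: t_def)
      have "t * (?v + N + 1) = ?v - y" using pos by (simp add: t_def)
      then have "t * (?v + N) \<le> ?v - y" using \<open>0 < t\<close> by (simp add: algebra_simps)
      then show "y \<le> (1 - t) * ?v + t * (- N)" by (simp add: algebra_simps)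
    qed
    \<comment> \<open>Mixing the top point over \<open>(x, z)\<close> with the bottom point of slab
      \<open>k\<close> over the same \<open>x\<close> gives height at least \<open>y\<close>. The
      hull allows lowering it to \<open>y\<close>, and the halfspaces do not involve
      \<open>z\<close>.\<close>
    have moved: "(x, y, (1 - t) *\<^sub>R z + t *\<^sub>R axis k 1) \<in> R_sharp D w b" for k
    proof -
      have "(x, ?v, z) \<in> ?P"
        using pq z Ny hull by fastforce
      moreover have "(x, - N, axis k 1) \<in> ?P"
        using \<open>x \<in> D\<close> N[rule_format, of x k] exhaust_2[of k]
        by (intro hull_inc) (auto simp: slab_def)
      ultimately have "(1 - t) *\<^sub>R (x, ?v, z) + t *\<^sub>R (x, - N, axis k 1) \<in> ?P"
        using t by (intro convexD) auto
      then have "(x, (1 - t) * ?v + t * (- N), (1 - t) *\<^sub>R z + t *\<^sub>R axis k 1) \<in> ?P"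
        by (simp add: algebra_simps)
      then have "(x, y, (1 - t) *\<^sub>R z + t *\<^sub>R axis k 1) \<in> ?P"
        using t(3) Ny unfolding hull by (meson order_trans)
      then show ?thesis
        using y unfolding R_eq by (auto simp: inner_prod_def algebra_simps)
    qed
    \<comment> \<open>The two displacements towards the unit vectors average out, since
      \<open>z\<close> is the combination of these vectors with its own coordinates as
      weights.\<close>
    have "z = z $ 1 *\<^sub>R ((1 - t) *\<^sub>R z + t *\<^sub>R axis 1 1) + z $ 2 *\<^sub>R ((1 - t) *\<^sub>R z + t *\<^sub>R axis 2 1)"
      (is "z = ?r")
    proof -
      have "?r = (z $ 1 + z $ 2) *\<^sub>R (1 - t) *\<^sub>R z + t *\<^sub>R (z $ 1 *\<^sub>R axis 1 1 + z $ 2 *\<^sub>R axis 2 1)"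
        by (simp add: algebra_simps)
      also have "\<dots> = z"
        using vec_eq_axis_combination_2[of z] zpos by (simp add: algebra_simps)
      finally show ?thesis by simp
    qed
    moreover have "x = z $ 1 *\<^sub>R x + z $ 2 *\<^sub>R x" "y = z $ 1 * y + z $ 2 * y"
      using zpos by (simp_all flip: scaleR_left_distrib distrib_right)
    ultimately show False
      using moved t axes
      by (intro not_between[of "(x, y, (1 - t) *\<^sub>R z + t *\<^sub>R axis 1 1)"
                              "(x, y, (1 - t) *\<^sub>R z + t *\<^sub>R axis 2 1)"]) auto
  qed
qed

theorem corollary1:
  fixes D :: "(real ^ 'n) set"
    and w :: "2 \<Rightarrow> real ^ 'n"
    and b :: "2 \<Rightarrow> real"
    and f :: "2 \<Rightarrow> real ^ 'n \<Rightarrow> real"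
  assumes "polyhedron D" and "bounded D"
    and "\<And>k x. x \<in> D \<Longrightarrow> f k x = w k \<bullet> x + b k"
    and "\<exists>x\<in>D. f 1 x > f 2 x"
    and "\<exists>x\<in>D. f 2 x > f 1 x"
  shows "ideal_mip_formulation (R_sharp D w b) {(x, y). x \<in> D \<and> y = max (f 1 x) (f 2 x)}"
proof -
  have D: "polytope D"
    using assms(1,2) by (simp add: polytope_eq_bounded_polyhedron)
  have "x \<in> D \<and> y = max (f 1 x) (f 2 x) \<longleftrightarrow> (\<exists>z\<in>binary_vectors. (x, y, z) \<in> R_sharp D w b)"
    for x y
  proof -
    have "z = axis 1 1 \<or> z = axis 2 1" if "z \<in> unit_simplex" "z \<in> binary_vectors" for z :: "real ^ 2"
      using that vec_eq_axis_combination_2[of z]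
      by (auto simp: unit_simplex_2 unit_simplex_2_binary_iff)
    then have "(\<exists>z\<in>binary_vectors. (x, y, z) \<in> R_sharp D w b) \<longleftrightarrow>
        (\<exists>k. (x, y, axis k 1) \<in> R_sharp D w b)"
      using axis_in_binary_vectors mem_R_sharp_iff[OF D] by metis
    \<comment> \<open>The admissible \<open>k\<close> are the indices at which the maximum is
      attained.\<close>
    also have "\<dots> \<longleftrightarrow> x \<in> D \<and> y = max (f 1 x) (f 2 x)"
      unfolding mem_R_sharp_axis[OF D] forall_2 ex_2 using assms(3) by auto
    finally show ?thesis by simp
  qed
  then show ?thesis
    using polyhedron_R_sharp[OF D] extreme_point_R_sharp_binary[OF D]
    by (simp add: ideal_mip_formulation_def mip_formulation_def)
qed

end
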